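(* Let $X$ be a set with $|X|=n=2$ and let $\tau$ be the discrete topology on $X$. Then the discrete topological graph $G_\tau$ of $X$ is isomorphic to the complete graph $K_2$.
   Context: For a non-empty set $X$ with the discrete topology $\tau$ (so $\tau$ is the family of all subsets of $X$), the discrete topological graph $G_\tau=(V,E)$ is the simple undirected graph with vertex set $V=\{A\in\tau : A\neq\emptyset,\ A\neq X\}$ in which two vertices $A,B$ are adjacent if and only if $A\cap B=\emptyset$. *)

theory Defs
  imports "HOL-Analysis.Abstract_Topology" "Graph_Theory.Graph_Theory"
begin

text \<open>
  As usual in \<^theory>\<open>Graph_Theory.Digraph\<close>, an undirected edge \<open>AB\<close> is represented by the two
  arcs \<open>(A, B)\<close> and \<open>(B, A)\<close>.
\<close>

definition discrete_topological_graph :: "'a set \<Rightarrow> 'a set pair_pre_digraph" where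
  "discrete_topological_graph X =
     (let V = {A. openin (discrete_topology X) A \<and> A \<noteq> {} \<and> A \<noteq> X}
      in \<lparr> pverts = V, parcs = {(A, B). A \<in> V \<and> B \<in> V \<and> A \<inter> B = {}} \<rparr>)"

lemma discrete_topological_graph_simple_undirected:
  "pair_bidirected_digraph (discrete_topological_graph X)"
  by unfold_locales (auto simp: discrete_topological_graph_def symmetric_def intro!: symI)

text \<open>
  The library has no distinguished graph \<open>K\<^sub>n\<close>, only the predicate \<^const>\<open>complete_digraph\<close>, which
  fixes a graph up to isomorphism. It can be satisfied for every \<open>n\<close>:
\<close>

lemma complete_digraph_standard:
  "complete_digraph n
     (with_proj \<lparr> pverts = {..<n}, parcs = {(i, j). i < n \<and> j < n \<and> i \<noteq> j} \<rparr>)"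
  by (auto simp: complete_digraph_pair_def)

end

theory Submission
  imports Defs
begin

text \<open>
  If \<open>X = {x, y}\<close> has two points, the only subsets other than \<open>{}\<close> and \<open>X\<close> are \<open>{x}\<close> and \<open>{y}\<close>.
  These two are disjoint from each other, while neither is disjoint from itself, so the discrete
  topological graph has two vertices and every pair of distinct vertices is adjacent.

  It remains to pass from being a complete graph on two vertices to being isomorphic to any given
  one. In a graph without multiple arcs an arc is determined by its end points, so a bijection of
  vertices that respects adjacency extends to the arcs
  (\<open>digraph_iso_if_bij_betw_verts\<close>). In complete graphs adjacency is just distinctness,
  so every bijection of vertices qualifies (\<open>complete_digraph_unique\<close>).
\<close>

text \<open>
  The arc map sends an arc with ends \<open>(u, v)\<close> to the only arc of \<open>H\<close> with ends \<open>(f u, f v)\<close>; both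
  graphs must be free of multiple arcs, \<open>G\<close> for this map to be injective and \<open>H\<close> for it to be
  well defined.
\<close>

lemma digraph_iso_if_bij_betw_verts:
  assumes G: "nomulti_digraph G" and H: "nomulti_digraph H"
    and f: "bij_betw f (verts G) (verts H)"
    and ends: "map_prod f f ` arcs_ends G = arcs_ends H"
  shows "digraph_iso G H"
proof -
  interpret G: nomulti_digraph G by (rule G)
  interpret H: nomulti_digraph H by (rule H)
  define arc_of where "arc_of = the_inv_into (arcs H) (arc_to_ends H)"
  define g where "g = arc_of \<circ> (map_prod f f \<circ> arc_to_ends G)"
  define hom where
    "hom = \<lparr>iso_verts = f, iso_arcs = g, iso_head = head H, iso_tail = tail H\<rparr>"
  have G_ends: "bij_betw (arc_to_ends G) (arcs G) (arcs_ends G)"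
    by (simp add: bij_betw_def G.inj_on_arc_to_ends arcs_ends_def)
  have H_ends: "bij_betw (arc_to_ends H) (arcs H) (arcs_ends H)"
    by (simp add: bij_betw_def H.inj_on_arc_to_ends arcs_ends_def)
  have "arcs_ends G \<subseteq> verts G \<times> verts G"
    by (auto simp: arcs_ends_conv)
  moreover have "inj_on (map_prod f f) (verts G \<times> verts G)"
    using f by (simp add: bij_betw_def map_prod_inj_on)
  ultimately have "bij_betw (map_prod f f) (arcs_ends G) (arcs_ends H)"
    using ends by (simp add: bij_betw_def inj_on_subset)
  moreover have "bij_betw arc_of (arcs_ends H) (arcs H)"
    unfolding arc_of_def by (rule bij_betw_the_inv_into[OF H_ends])
  ultimately have g: "bij_betw g (arcs G) (arcs H)"
    unfolding g_def by (intro bij_betw_trans[OF bij_betw_trans[OF G_ends]])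
  have g_ends: "tail H (g a) = f (tail G a) \<and> head H (g a) = f (head G a)"
    if "a \<in> arcs G" for a
  proof -
    have "map_prod f f (arc_to_ends G a) \<in> arcs_ends H"
      using that ends by (auto simp: arcs_ends_def)
    then have "arc_to_ends H (g a) = map_prod f f (arc_to_ends G a)"
      using H_ends unfolding g_def arc_of_def comp_apply
      by (rule f_the_inv_into_f_bij_betw[rotated])
    then show ?thesis
      by (simp add: arc_to_ends_def)
  qed
  have "pre_digraph.digraph_isomorphism G hom"
    using f g g_ends G.wf_digraph
    by (simp add: pre_digraph.digraph_isomorphism_def hom_def bij_betw_def)
  moreover have "H = app_iso hom G"
    using f g by (simp add: app_iso_def hom_def bij_betw_def)
  ultimately show ?thesis
    by (auto simp: digraph_iso_def)
qed

lemma complete_digraph_unique: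
  assumes G: "complete_digraph n G" and H: "complete_digraph n H"
  shows "digraph_iso G H"
proof -
  interpret G: graph G using G by (simp add: complete_digraph_def)
  interpret H: graph H using H by (simp add: complete_digraph_def)
  have "card (verts G) = card (verts H)"
    using G H by (simp add: complete_digraph_def)
  then obtain f where f: "bij_betw f (verts G) (verts H)"
    using finite_same_card_bij G.finite_verts H.finite_verts by blast
  then have inj: "inj_on f (verts G)" and img: "f ` verts G = verts H"
    by (auto simp: bij_betw_def)
  have "map_prod f f ` {(u, v). (u, v) \<in> verts G \<times> verts G \<and> u \<noteq> v}
      = {(u, v). (u, v) \<in> verts H \<times> verts H \<and> u \<noteq> v}"
    unfolding img[symmetric] by (auto simp: inj_on_eq_iff[OF inj] image_iff Bex_def)
  then have "map_prod f f ` arcs_ends G = arcs_ends H"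
    using G H by (simp add: complete_digraph_def)
  with f show ?thesis
    by (intro digraph_iso_if_bij_betw_verts G.nomulti_digraph H.nomulti_digraph)
qed

lemma complete_discrete_topological_graph:
  assumes "card X = 2"
  shows "complete_digraph 2 (with_proj (discrete_topological_graph X))"
proof -
  obtain x y where X: "X = {x, y}" and "x \<noteq> y"
    using assms by (auto simp: card_2_iff)
  have "{A. openin (discrete_topology X) A \<and> A \<noteq> {} \<and> A \<noteq> X} = Pow {x, y} - {{}, {x, y}}"
    by (auto simp: X)
  also have "\<dots> = {{x}, {y}}"
    using \<open>x \<noteq> y\<close> unfolding Pow_insert Pow_empty by auto
  finally have "{A. openin (discrete_topology X) A \<and> A \<noteq> {} \<and> A \<noteq> X} = {{x}, {y}}" .
  then have "discrete_topological_graph X =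
      \<lparr>pverts = {{x}, {y}}, parcs = {({x}, {y}), ({y}, {x})}\<rparr>"
    using \<open>x \<noteq> y\<close> by (auto simp: discrete_topological_graph_def Let_def)
  then show ?thesis
    using \<open>x \<noteq> y\<close> by (auto simp: complete_digraph_pair_def)
qed

theorem proposition2p1:
  fixes X :: "'a set" and H :: "('b, 'c) pre_digraph"
  assumes "card X = 2"
    and "complete_digraph 2 H"
  shows "digraph_iso (with_proj (discrete_topological_graph X)) H"
  using complete_discrete_topological_graph[OF assms(1)] assms(2)
  by (rule complete_digraph_unique)

end
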